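(* There exist uncountably many pairwise nonisomorphic inverse monoids $S$ such that $S$ is 3-generated (as an inverse monoid), and: (i) every $\mathcal{R}$-class of $S$ is finite; (ii) $\mu_S(s)$ is infinite for some $s \in S$.
   Context: For an inverse semigroup $S$, $E(S)$ denotes its semilattice of idempotents and $\leq$ its natural partial order: $a \leq b$ if and only if $a = eb$ for some $e \in E(S)$. For $s \in S$, let $\lambda_S(s) = \{ t \in S \mid t \leq s\}$, and let $\mu_S(s)$ denote the set of maximal elements (with respect to $\leq$) of $\lambda_S(s) \cap E(S)$. $\mathcal{R}$ is Green's relation; in an inverse semigroup, $s \mathrel{\mathcal{R}} t$ if and only if $ss^{-1} = tt^{-1}$. An inverse monoid is 3-generated if it is generated, as an inverse monoid (i.e. using products, inverses and the identity), by a set of three elements. *)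

theory Defs
  imports "HOL-Algebra.Group" "HOL-Library.Countable_Set"
begin

locale inverse_monoid = monoid +
  assumes ex1_generalized_inverse:
    "s \<in> carrier G \<Longrightarrow> \<exists>!t. t \<in> carrier G \<and> s \<otimes> t \<otimes> s = s \<and> t \<otimes> s \<otimes> t = t"

text \<open>The library's \<^const>\<open>m_inv\<close> is the group-theoretic inverse of a unit, so the inverse in the
  sense of inverse semigroups needs its own operation.\<close>

definition isg_inv :: "('a, 'b) monoid_scheme \<Rightarrow> 'a \<Rightarrow> 'a" where
  "isg_inv S s =
     (THE t. t \<in> carrier S \<and> s \<otimes>\<^bsub>S\<^esub> t \<otimes>\<^bsub>S\<^esub> s = s \<and> t \<otimes>\<^bsub>S\<^esub> s \<otimes>\<^bsub>S\<^esub> t = t)"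

definition idempotents :: "('a, 'b) monoid_scheme \<Rightarrow> 'a set" where
  "idempotents S = {e \<in> carrier S. e \<otimes>\<^bsub>S\<^esub> e = e}"

definition nat_order :: "('a, 'b) monoid_scheme \<Rightarrow> 'a \<Rightarrow> 'a \<Rightarrow> bool" where
  "nat_order S a b \<longleftrightarrow>
     a \<in> carrier S \<and> b \<in> carrier S \<and> (\<exists>e \<in> idempotents S. a = e \<otimes>\<^bsub>S\<^esub> b)"

definition lambda_set :: "('a, 'b) monoid_scheme \<Rightarrow> 'a \<Rightarrow> 'a set" where
  "lambda_set S s = {t \<in> carrier S. nat_order S t s}"

definition mu_set :: "('a, 'b) monoid_scheme \<Rightarrow> 'a \<Rightarrow> 'a set" where
  "mu_set S s = {e \<in> lambda_set S s \<inter> idempotents S.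
     \<forall>f \<in> lambda_set S s \<inter> idempotents S. nat_order S e f \<longrightarrow> f = e}"

text \<open>Green's relation R: equality of principal right ideals.  A monoid has an identity, so the
  principal right ideal of \<open>a\<close> is \<open>a S\<close>.\<close>

definition green_R :: "('a, 'b) monoid_scheme \<Rightarrow> 'a \<Rightarrow> 'a \<Rightarrow> bool" where
  "green_R S a b \<longleftrightarrow> a \<in> carrier S \<and> b \<in> carrier S \<and>
     (\<lambda>x. a \<otimes>\<^bsub>S\<^esub> x) ` carrier S = (\<lambda>x. b \<otimes>\<^bsub>S\<^esub> x) ` carrier S"

definition R_class :: "('a, 'b) monoid_scheme \<Rightarrow> 'a \<Rightarrow> 'a set" where
  "R_class S a = {b \<in> carrier S. green_R S a b}"

inductive_set inv_mon_generate :: "('a, 'b) monoid_scheme \<Rightarrow> 'a set \<Rightarrow> 'a set"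
  for S and X where
  one: "\<one>\<^bsub>S\<^esub> \<in> inv_mon_generate S X"
| incl: "x \<in> X \<Longrightarrow> x \<in> inv_mon_generate S X"
| inv: "x \<in> inv_mon_generate S X \<Longrightarrow> isg_inv S x \<in> inv_mon_generate S X"
| mult: "x \<in> inv_mon_generate S X \<Longrightarrow> y \<in> inv_mon_generate S X \<Longrightarrow>
    x \<otimes>\<^bsub>S\<^esub> y \<in> inv_mon_generate S X"

definition three_generated :: "('a, 'b) monoid_scheme \<Rightarrow> bool" where
  "three_generated S \<longleftrightarrow>
     (\<exists>X. X \<subseteq> carrier S \<and> card X = 3 \<and> inv_mon_generate S X = carrier S)"

context inverse_monoid
begin

lemma isg_inv_props:
  assumes "s \<in> carrier G"
  shows "isg_inv G s \<in> carrier G"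
    and "s \<otimes> isg_inv G s \<otimes> s = s"
    and "isg_inv G s \<otimes> s \<otimes> isg_inv G s = isg_inv G s"
  using theI'[OF ex1_generalized_inverse[OF assms]] unfolding isg_inv_def by auto

lemma principal_right_ideal_eq:
  assumes s: "s \<in> carrier G"
  shows "(\<lambda>x. s \<otimes> x) ` carrier G = (\<lambda>x. s \<otimes> isg_inv G s \<otimes> x) ` carrier G"
proof (intro equalityI subsetI)
  note p = isg_inv_props[OF s]
  fix y
  { assume "y \<in> (\<lambda>x. s \<otimes> x) ` carrier G"
    then obtain x where x: "x \<in> carrier G" "y = s \<otimes> x" by auto
    then have "y = s \<otimes> isg_inv G s \<otimes> (s \<otimes> x)"
      using p s by (metis m_assoc m_closed)
    then show "y \<in> (\<lambda>x. s \<otimes> isg_inv G s \<otimes> x) ` carrier G"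
      using x s by blast }
  { assume "y \<in> (\<lambda>x. s \<otimes> isg_inv G s \<otimes> x) ` carrier G"
    then obtain x where x: "x \<in> carrier G" "y = s \<otimes> isg_inv G s \<otimes> x" by auto
    then have "y = s \<otimes> (isg_inv G s \<otimes> x)"
      using p s by (simp add: m_assoc)
    then show "y \<in> (\<lambda>x. s \<otimes> x) ` carrier G"
      using x p by blast }
qed

lemma green_R_iff:
  assumes s: "s \<in> carrier G" and t: "t \<in> carrier G"
  shows "green_R G s t \<longleftrightarrow> s \<otimes> isg_inv G s = t \<otimes> isg_inv G t"
proof
  assume "s \<otimes> isg_inv G s = t \<otimes> isg_inv G t"
  then show "green_R G s t"
    using principal_right_ideal_eq[OF s] principal_right_ideal_eq[OF t] s t
    by (simp add: green_R_def)
next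
  assume R: "green_R G s t"
  note ps = isg_inv_props[OF s] and pt = isg_inv_props[OF t]
  define e where "e = s \<otimes> isg_inv G s"
  define f where "f = t \<otimes> isg_inv G t"
  have e: "e \<in> carrier G" "e \<otimes> e = e" and f: "f \<in> carrier G" "f \<otimes> f = f"
    unfolding e_def f_def using s t ps pt by (metis m_assoc m_closed)+
  have I: "(\<lambda>x. e \<otimes> x) ` carrier G = (\<lambda>x. f \<otimes> x) ` carrier G"
    using R principal_right_ideal_eq[OF s] principal_right_ideal_eq[OF t]
    unfolding green_R_def e_def f_def by simp
  have "e \<in> (\<lambda>x. f \<otimes> x) ` carrier G" "f \<in> (\<lambda>x. e \<otimes> x) ` carrier G"
    using I e f by (metis imageI)+
  then obtain x y where "x \<in> carrier G" "e = f \<otimes> x" "y \<in> carrier G" "f = e \<otimes> y"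
    by blast
  then have fe: "f \<otimes> e = e" and ef: "e \<otimes> f = f"
    using e f by (metis m_assoc)+
  then show "s \<otimes> isg_inv G s = t \<otimes> isg_inv G t"
    using ex1_generalized_inverse[OF e(1)] e f unfolding e_def[symmetric] f_def[symmetric]
    by metis
qed

end

end

theory Submission
  imports Defs
begin

text \<open>Let \<open>M\<close> consist of the tuples \<open>(p, q, B, n)\<close>, where \<open>[p, q]\<close> is an integer interval containing
  \<open>0\<close> and \<open>n\<close>, and \<open>B \<subseteq> [p, q]\<close> is a set of marked points; a product translates the second
  picture by \<open>n\<close> and takes the union. This inverse monoid is generated by the unit step \<open>a\<close> and the
  mark \<open>b\<close> at the origin, and its R-classes are finite because \<open>n\<close> ranges over \<open>[p, q]\<close>.
  For a set \<open>K\<close> of positive integers, the tuples in which two marks have a difference in \<open>K\<close> form an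
  ideal \<open>I\<close>. Adjoin a central involution \<open>c\<close> and impose \<open>x c = x\<close> for all \<open>x \<in> I\<close>. The
  idempotents below \<open>c\<close> are then exactly those of \<open>I\<close>, and infinitely many of them are maximal as
  soon as \<open>1 \<in> K\<close>.

  An isomorphism from one of these monoids onto a countable monoid \<open>T\<close> is determined, as far as \<open>K\<close>
  is concerned, by the images of \<open>a\<close>, its inverse, \<open>b\<close> and \<open>c\<close>, since \<open>k \<in> K\<close> can be read off from
  whether \<open>c\<close> fixes the element with marks at \<open>0\<close> and \<open>k\<close>. Hence only countably many \<open>K\<close> give
  monoids isomorphic to \<open>T\<close>, so uncountably many isomorphism types occur.\<close>

section \<open>Isomorphisms of inverse monoids\<close>

lemma monoid_iso_sym:
  assumes "monoid S" and "S \<cong> T"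
  shows "T \<cong> S"
proof -
  interpret S: monoid S by fact
  obtain h where h: "h \<in> hom S T" "bij_betw h (carrier S) (carrier T)"
    using assms(2) by (auto simp: is_iso_def iso_def)
  let ?g = "inv_into (carrier S) h"
  have g: "bij_betw ?g (carrier T) (carrier S)"
    using h(2) by (rule bij_betw_inv_into)
  have "?g (x \<otimes>\<^bsub>T\<^esub> y) = ?g x \<otimes>\<^bsub>S\<^esub> ?g y" if "x \<in> carrier T" "y \<in> carrier T" for x y
  proof -
    have mem: "?g x \<in> carrier S" "?g y \<in> carrier S"
      using g that by (auto simp: bij_betw_def)
    then have "h (?g x \<otimes>\<^bsub>S\<^esub> ?g y) = x \<otimes>\<^bsub>T\<^esub> y"
      using h that by (simp add: hom_mult bij_betw_inv_into_right)
    then show ?thesis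
      using h(2) mem by (metis S.m_closed bij_betw_inv_into_left)
  qed
  with g have "?g \<in> iso T S"
    by (auto simp: iso_def hom_def bij_betw_def)
  then show ?thesis
    by (auto simp: is_iso_def)
qed

text \<open>With only countably many representatives, the index type would be a countable union of
  countable isomorphism classes.\<close>

lemma uncountable_pairwise_nonisomorphic:
  fixes T :: "'i \<Rightarrow> 'a monoid"
  assumes mon: "\<And>i. monoid (T i)"
    and unc: "uncountable (UNIV :: 'i set)"
    and cnt: "\<And>i. countable {j. T j \<cong> T i}"
  shows "\<exists>\<F> \<subseteq> range T. uncountable \<F> \<and> pairwise (\<lambda>S S'. \<not> S \<cong> S') \<F>"
proof -
  have sym: "T i \<cong> T j \<Longrightarrow> T j \<cong> T i" for i j
    using mon monoid_iso_sym by blast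
  have refl: "T i \<cong> T i" for i
    using iso_set_refl unfolding is_iso_def by blast
  define rep where "rep i = T (SOME j. T j \<cong> T i)" for i
  have rep: "rep i \<cong> T i" for i
    unfolding rep_def by (rule someI[of "\<lambda>j. T j \<cong> T i"]) (rule refl)
  have rep': "T i \<cong> rep i" for i
    using rep[of i] sym unfolding rep_def by blast
  have eq: "rep i = rep j" if "rep i \<cong> rep j" for i j
  proof -
    have "T i \<cong> T j"
      using rep' that rep iso_trans by metis
    \<comment> \<open>\<open>SOME\<close> depends only on this predicate, so isomorphic indices
      receive the same representative.\<close>
    then have "(\<lambda>k. T k \<cong> T i) = (\<lambda>k. T k \<cong> T j)"
      using sym iso_trans by (metis (no_types, lifting))
    then show ?thesis by (simp add: rep_def)
  qed
  have "uncountable (range rep)"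
  proof
    assume "countable (range rep)"
    moreover have "countable {j. T j \<cong> S}" if "S \<in> range rep" for S
      using that cnt by (auto simp: rep_def)
    ultimately have "countable (\<Union>S\<in>range rep. {j. T j \<cong> S})"
      by (intro countable_UN) auto
    moreover have "(\<Union>S\<in>range rep. {j. T j \<cong> S}) = UNIV"
      using rep' by auto
    ultimately show False using unc by simp
  qed
  moreover have "pairwise (\<lambda>S S'. \<not> S \<cong> S') (range rep)"
    using eq by (auto simp: pairwise_def)
  moreover have "range rep \<subseteq> range T"
    by (auto simp: rep_def)
  ultimately show ?thesis by blast
qed

section \<open>Transport of the invariants along an isomorphism\<close>

locale inverse_monoid_iso = S: inverse_monoid S + T: monoid T
  for S :: "('a, 'c) monoid_scheme" and T :: "('b, 'd) monoid_scheme" +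
  fixes h
  assumes h: "h \<in> iso S T"
begin

lemma image_carrier: "h ` carrier S = carrier T"
  and inj: "inj_on h (carrier S)"
  using h by (auto simp: iso_def bij_betw_def)

lemma h_closed: "x \<in> carrier S \<Longrightarrow> h x \<in> carrier T"
  using image_carrier by blast

lemma h_mult:
  "x \<in> carrier S \<Longrightarrow> y \<in> carrier S \<Longrightarrow> h (x \<otimes>\<^bsub>S\<^esub> y) = h x \<otimes>\<^bsub>T\<^esub> h y"
  using h by (auto simp: iso_def hom_def)

lemma h_eq_iff: "x \<in> carrier S \<Longrightarrow> y \<in> carrier S \<Longrightarrow> h x = h y \<longleftrightarrow> x = y"
  using inj by (auto simp: inj_on_def)

text \<open>\<open>hom\<close> only asks that products be preserved; the identity is reached through
  a preimage, which surjectivity supplies.\<close>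

lemma h_one: "h \<one>\<^bsub>S\<^esub> = \<one>\<^bsub>T\<^esub>"
proof -
  obtain x where x: "x \<in> carrier S" "h x = \<one>\<^bsub>T\<^esub>"
    using image_carrier T.one_closed by (metis imageE)
  have "h \<one>\<^bsub>S\<^esub> = h \<one>\<^bsub>S\<^esub> \<otimes>\<^bsub>T\<^esub> h x"
    using x h_closed by simp
  also have "\<dots> = h x"
    using x(1) by (simp flip: h_mult)
  finally show ?thesis using x by simp
qed

lemma generalized_inverse_iff:
  assumes "x \<in> carrier S" "y \<in> carrier S"
  shows "h x \<otimes>\<^bsub>T\<^esub> h y \<otimes>\<^bsub>T\<^esub> h x = h x \<longleftrightarrow> x \<otimes>\<^bsub>S\<^esub> y \<otimes>\<^bsub>S\<^esub> x = x"
  using assms by (simp add: h_eq_iff flip: h_mult)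

lemma inverse_monoid_T: "inverse_monoid T"
proof
  fix s assume "s \<in> carrier T"
  then obtain x where x: "x \<in> carrier S" "s = h x"
    using image_carrier by blast
  obtain y where y: "y \<in> carrier S" "x \<otimes>\<^bsub>S\<^esub> y \<otimes>\<^bsub>S\<^esub> x = x" "y \<otimes>\<^bsub>S\<^esub> x \<otimes>\<^bsub>S\<^esub> y = y"
    and uniq: "\<And>z. z \<in> carrier S \<Longrightarrow> x \<otimes>\<^bsub>S\<^esub> z \<otimes>\<^bsub>S\<^esub> x = x \<Longrightarrow> z \<otimes>\<^bsub>S\<^esub> x \<otimes>\<^bsub>S\<^esub> z = z \<Longrightarrow> z = y"
    using S.ex1_generalized_inverse[OF x(1)] by metis
  show "\<exists>!t. t \<in> carrier T \<and> s \<otimes>\<^bsub>T\<^esub> t \<otimes>\<^bsub>T\<^esub> s = s \<and> t \<otimes>\<^bsub>T\<^esub> s \<otimes>\<^bsub>T\<^esub> t = t"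
  proof (rule ex1I[of _ "h y"])
    show "h y \<in> carrier T \<and> s \<otimes>\<^bsub>T\<^esub> h y \<otimes>\<^bsub>T\<^esub> s = s \<and> h y \<otimes>\<^bsub>T\<^esub> s \<otimes>\<^bsub>T\<^esub> h y = h y"
      using x y by (simp add: generalized_inverse_iff h_closed)
  next
    fix t assume t: "t \<in> carrier T \<and> s \<otimes>\<^bsub>T\<^esub> t \<otimes>\<^bsub>T\<^esub> s = s \<and> t \<otimes>\<^bsub>T\<^esub> s \<otimes>\<^bsub>T\<^esub> t = t"
    then obtain z where z: "z \<in> carrier S" "t = h z"
      using image_carrier by blast
    then show "t = h y"
      using t x uniq by (simp add: generalized_inverse_iff)
  qed
qed

sublocale T: inverse_monoid T
  by (rule inverse_monoid_T)

lemma h_isg_inv: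
  assumes x: "x \<in> carrier S"
  shows "h (isg_inv S x) = isg_inv T (h x)"
  using T.ex1_generalized_inverse[OF h_closed[OF x]] T.isg_inv_props[OF h_closed[OF x]]
    S.isg_inv_props[OF x] x
  by (metis generalized_inverse_iff h_closed)

lemma idempotents_image: "idempotents T = h ` idempotents S"
  unfolding idempotents_def image_carrier[symmetric]
  by (auto simp: h_eq_iff simp flip: h_mult)

lemma nat_order_iff:
  assumes "x \<in> carrier S" "y \<in> carrier S"
  shows "nat_order T (h x) (h y) \<longleftrightarrow> nat_order S x y"
proof -
  have "h x = h e \<otimes>\<^bsub>T\<^esub> h y \<longleftrightarrow> x = e \<otimes>\<^bsub>S\<^esub> y" if "e \<in> idempotents S" for e
    using that assms by (simp add: idempotents_def h_eq_iff flip: h_mult)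
  then show ?thesis
    using assms by (auto simp: nat_order_def idempotents_image h_closed)
qed

lemma lambda_set_image:
  assumes "s \<in> carrier S"
  shows "lambda_set T (h s) = h ` lambda_set S s"
  unfolding lambda_set_def image_carrier[symmetric]
  using assms by (auto simp: nat_order_iff)

lemma mu_set_image:
  assumes s: "s \<in> carrier S"
  shows "mu_set T (h s) = h ` mu_set S s"
proof -
  let ?L = "lambda_set S s \<inter> idempotents S"
  have sub: "lambda_set S s \<subseteq> carrier S" "idempotents S \<subseteq> carrier S"
    by (auto simp: lambda_set_def idempotents_def)
  have L: "lambda_set T (h s) \<inter> idempotents T = h ` ?L"
    unfolding lambda_set_image[OF s] idempotents_image
    by (rule inj_on_image_Int[OF inj sub, symmetric])
  have "(\<forall>f \<in> h ` ?L. nat_order T (h e) f \<longrightarrow> f = h e) \<longleftrightarrow>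
      (\<forall>f \<in> ?L. nat_order S e f \<longrightarrow> f = e)" if "e \<in> ?L" for e
    using that sub by (simp add: nat_order_iff h_eq_iff subset_iff)
  then have "{e \<in> h ` ?L. \<forall>f \<in> h ` ?L. nat_order T e f \<longrightarrow> f = e} =
      h ` {e \<in> ?L. \<forall>f \<in> ?L. nat_order S e f \<longrightarrow> f = e}"
    by (simp only: Compr_image_eq cong: conj_cong)
  then show ?thesis
    unfolding mu_set_def L .
qed

lemma green_R_iff:
  assumes "x \<in> carrier S" "y \<in> carrier S"
  shows "green_R T (h x) (h y) \<longleftrightarrow> green_R S x y"
proof -
  have ideal: "(\<lambda>z. h w \<otimes>\<^bsub>T\<^esub> z) ` carrier T = h ` (\<lambda>z. w \<otimes>\<^bsub>S\<^esub> z) ` carrier S"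
    if "w \<in> carrier S" for w
    unfolding image_carrier[symmetric] image_image using that by (simp add: h_mult)
  have "(\<lambda>z. w \<otimes>\<^bsub>S\<^esub> z) ` carrier S \<subseteq> carrier S" if "w \<in> carrier S" for w
    using that by auto
  then show ?thesis
    using assms by (simp add: green_R_def ideal h_closed inj_on_image_eq_iff[OF inj])
qed

lemma R_class_image:
  assumes "x \<in> carrier S"
  shows "R_class T (h x) = h ` R_class S x"
  unfolding R_class_def image_carrier[symmetric]
  using assms by (auto simp: green_R_iff)

lemma three_generated_T:
  assumes "three_generated S"
  shows "three_generated T"
proof -
  obtain X where X: "X \<subseteq> carrier S" "card X = 3" "inv_mon_generate S X = carrier S"
    using assms by (auto simp: three_generated_def)
  have "h x \<in> inv_mon_generate T (h ` X)" if "x \<in> inv_mon_generate S X" for x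
    using that
  proof induction
    case one
    show ?case unfolding h_one by (rule inv_mon_generate.one)
  next
    case (incl x)
    then show ?case by (intro inv_mon_generate.incl imageI)
  next
    case (inv x)
    then show ?case using X(3) by (simp add: h_isg_inv inv_mon_generate.inv)
  next
    case (mult x y)
    then show ?case using X(3) by (simp add: h_mult inv_mon_generate.mult)
  qed
  then have "carrier T \<subseteq> inv_mon_generate T (h ` X)"
    unfolding image_carrier[symmetric] using X(3) by auto
  moreover have "y \<in> carrier T" if "y \<in> inv_mon_generate T (h ` X)" for y
    using that X(1) by induction (auto simp: h_closed T.isg_inv_props)
  moreover have "card (h ` X) = 3"
    using X inj by (metis card_image inj_on_subset)
  ultimately show ?thesis
    using X(1) h_closed unfolding three_generated_def by (intro exI[of _ "h ` X"]) blast
qed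

end

text \<open>Transport of structure along an injective \<open>h\<close>; it serves to place countable
  monoids on sets of natural numbers.\<close>

definition image_monoid :: "('a \<Rightarrow> 'b) \<Rightarrow> ('a, 'c) monoid_scheme \<Rightarrow> 'b monoid" where
  "image_monoid h S = \<lparr>carrier = h ` carrier S,
     mult = (\<lambda>x y. h (inv_into (carrier S) h x \<otimes>\<^bsub>S\<^esub> inv_into (carrier S) h y)),
     one = h \<one>\<^bsub>S\<^esub>\<rparr>"

lemma inverse_monoid_iso_image_monoid:
  assumes "inverse_monoid S" and inj: "inj_on h (carrier S)"
  shows "inverse_monoid_iso S (image_monoid h S) h"
proof -
  interpret S: inverse_monoid S by fact
  have "monoid (image_monoid h S)"
    by (rule monoidI) (auto simp: image_monoid_def inj S.m_assoc)
  moreover have "h \<in> iso S (image_monoid h S)"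
    using inj by (auto simp: iso_def hom_def bij_betw_def image_monoid_def)
  ultimately show ?thesis
    by (simp add: inverse_monoid_iso_def inverse_monoid_iso_axioms_def S.inverse_monoid_axioms)
qed

section \<open>Intervals with marked points\<close>

definition has_gap :: "int set \<Rightarrow> int set \<Rightarrow> bool" where
  "has_gap K B \<longleftrightarrow> (\<exists>x\<in>B. \<exists>y\<in>B. y - x \<in> K)"

text \<open>Together with translation invariance, this makes the elements with a gap in
  \<open>K\<close> a two-sided ideal.\<close>

lemma has_gap_mono: "has_gap K B \<Longrightarrow> B \<subseteq> C \<Longrightarrow> has_gap K C"
  by (auto simp: has_gap_def)

lemma has_gap_translate [simp]:
  "has_gap K ((+) n ` B) \<longleftrightarrow> has_gap K B"
  "has_gap K ((\<lambda>x. x - n) ` B) \<longleftrightarrow> has_gap K B"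
  by (auto simp: has_gap_def)

text \<open>The final component of a tuple is the exponent of \<open>c\<close>; it is normalised to \<^const>\<open>False\<close> on the
  ideal where \<open>c\<close> acts trivially.\<close>

type_synonym marked = "int \<times> int \<times> int set \<times> int \<times> bool"

text \<open>\<open>t \<noteq> t'\<close> adds exponents modulo 2; the conjunct after it resets the
  exponent on the ideal.\<close>

fun marked_mult :: "int set \<Rightarrow> marked \<Rightarrow> marked \<Rightarrow> marked" where
  "marked_mult K (p, q, B, n, t) (p', q', B', n', t') =
     (min p (n + p'), max q (n + q'), B \<union> (+) n ` B', n + n',
      (t \<noteq> t') \<and> \<not> has_gap K (B \<union> (+) n ` B'))"

definition marked_carrier :: "int set \<Rightarrow> marked set" where
  "marked_carrier K = {(p, q, B, n, t). p \<le> 0 \<and> 0 \<le> q \<and> p \<le> n \<and> n \<le> q \<and> B \<subseteq> {p..q} \<and>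
     (t \<longrightarrow> \<not> has_gap K B)}"

definition marked_monoid :: "int set \<Rightarrow> marked monoid" where
  "marked_monoid K =
     \<lparr>carrier = marked_carrier K, mult = marked_mult K, one = (0, 0, {}, 0, False)\<rparr>"

lemma marked_monoid_simps [simp]:
  "carrier (marked_monoid K) = marked_carrier K"
  "mult (marked_monoid K) = marked_mult K"
  "one (marked_monoid K) = (0, 0, {}, 0, False)"
  by (simp_all add: marked_monoid_def)

lemma mem_marked_carrier [simp]:
  "(p, q, B, n, t) \<in> marked_carrier K \<longleftrightarrow>
     p \<le> 0 \<and> 0 \<le> q \<and> p \<le> n \<and> n \<le> q \<and> B \<subseteq> {p..q} \<and> (t \<longrightarrow> \<not> has_gap K B)"
  by (simp add: marked_carrier_def)

lemma countable_marked_carrier: "countable (marked_carrier K)"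
proof -
  have "marked_carrier K \<subseteq> UNIV \<times> UNIV \<times> Collect finite \<times> UNIV \<times> UNIV"
    using finite_subset[OF _ finite_atLeastAtMost_int] by (auto simp: marked_carrier_def)
  moreover have "countable (UNIV \<times> UNIV \<times> Collect finite \<times> UNIV \<times> UNIV :: marked set)"
    by (intro countable_SIGMA countable_Collect_finite) auto
  ultimately show ?thesis
    by (rule countable_subset)
qed

text \<open>A gap in a partial product persists in the whole product, so resetting the exponent
  early does not change the result.\<close>

lemma marked_mult_assoc:
  "marked_mult K (marked_mult K x y) z = marked_mult K x (marked_mult K y z)"
proof -
  obtain p q B n t where x: "x = (p, q, B, n, t)" by (cases x)
  obtain p' q' B' n' t' where y: "y = (p', q', B', n', t')" by (cases y)
  obtain p'' q'' B'' n'' t'' where z: "z = (p'', q'', B'', n'', t'')" by (cases z)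
  let ?C = "B \<union> (+) n ` B' \<union> (+) (n + n') ` B''"
  have C: "B \<union> (+) n ` (B' \<union> (+) n' ` B'') = ?C"
    by (auto simp: image_Un image_image add.assoc)
  have "\<not> has_gap K ?C \<Longrightarrow> \<not> has_gap K (B \<union> (+) n ` B')"
    using has_gap_mono[of K "B \<union> (+) n ` B'" ?C] by blast
  moreover have "\<not> has_gap K ?C \<Longrightarrow> \<not> has_gap K (B' \<union> (+) n' ` B'')"
    using has_gap_mono[of K "(+) n ` (B' \<union> (+) n' ` B'')" ?C] C
    by (metis Un_upper2 has_gap_translate(1))
  ultimately show ?thesis
    unfolding x y z marked_mult.simps C by (auto simp: min_def max_def)
qed

lemma marked_mult_closed:
  assumes "x \<in> marked_carrier K" "y \<in> marked_carrier K"
  shows "marked_mult K x y \<in> marked_carrier K"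
proof -
  obtain p q B n t where x: "x = (p, q, B, n, t)" by (cases x)
  obtain p' q' B' n' t' where y: "y = (p', q', B', n', t')" by (cases y)
  show ?thesis
    using assms unfolding x y by (auto simp: subset_iff min_le_iff_disj le_max_iff_disj)
qed

text \<open>The inverse is the same picture seen from its end point \<open>n\<close>. The equation
  \<open>xyx\<close> bounds the interval and marks of \<open>y\<close> from above with respect to
  inclusion, and \<open>yxy\<close> bounds them from below.\<close>

lemma marked_inverse_unique:
  assumes x: "(p, q, B, n, t) \<in> marked_carrier K" and y: "y \<in> marked_carrier K"
    and xyx: "marked_mult K (marked_mult K (p, q, B, n, t) y) (p, q, B, n, t) = (p, q, B, n, t)"
    and yxy: "marked_mult K (marked_mult K y (p, q, B, n, t)) y = y"
  shows "y = (p - n, q - n, (+) (- n) ` B, - n, t)"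
proof -
  obtain p' q' B' n' t' where y_eq: "y = (p', q', B', n', t')" by (cases y)
  have n': "n' = - n"
    using xyx by (simp add: y_eq)
  have p': "p' = p - n" and q': "q' = q - n"
    using xyx yxy by (auto simp: y_eq n' min_def max_def split: if_splits)
  have "(+) n ` B' \<subseteq> B" "(+) (- n) ` B \<subseteq> B'"
    using xyx yxy by (auto simp: y_eq n')
  then have B': "B' = (+) (- n) ` B"
    by (force simp: image_iff)
  have union: "B \<union> (+) n ` B' = B" and gap: "has_gap K B' \<longleftrightarrow> has_gap K B"
    unfolding B' by (simp_all only: has_gap_translate) (simp add: image_image)
  \<comment> \<open>Off the ideal, \<open>xyx\<close> says \<open>t + t' + t = t\<close> modulo 2;
    on it, both exponents are \<open>False\<close> by normalisation.\<close>
  have "t' = t"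
    using x y xyx unfolding y_eq n'
    by (cases "has_gap K B") (auto simp: union gap)
  then show ?thesis
    by (simp add: y_eq n' p' q' B')
qed

lemma inverse_monoid_marked_monoid: "inverse_monoid (marked_monoid K)"
proof -
  interpret monoid "marked_monoid K"
  proof (rule monoidI)
    fix x assume "x \<in> carrier (marked_monoid K)"
    then show "\<one>\<^bsub>marked_monoid K\<^esub> \<otimes>\<^bsub>marked_monoid K\<^esub> x = x"
      and "x \<otimes>\<^bsub>marked_monoid K\<^esub> \<one>\<^bsub>marked_monoid K\<^esub> = x"
      by (cases x; auto)+
  qed (simp_all add: marked_mult_assoc marked_mult_closed has_gap_def)
  show ?thesis
  proof
    fix s assume s: "s \<in> carrier (marked_monoid K)"
    obtain p q B n t where s_eq: "s = (p, q, B, n, t)" by (cases s)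
    let ?s' = "(p - n, q - n, (+) (- n) ` B, - n, t)"
    have "?s' \<in> marked_carrier K"
      using s by (auto simp: s_eq)
    moreover have "marked_mult K (marked_mult K s ?s') s = s"
      and "marked_mult K (marked_mult K ?s' s) ?s' = ?s'"
      using s by (auto simp: s_eq image_image)
    ultimately show "\<exists>!t. t \<in> carrier (marked_monoid K) \<and>
        s \<otimes>\<^bsub>marked_monoid K\<^esub> t \<otimes>\<^bsub>marked_monoid K\<^esub> s = s \<and>
        t \<otimes>\<^bsub>marked_monoid K\<^esub> s \<otimes>\<^bsub>marked_monoid K\<^esub> t = t"
      using marked_inverse_unique s unfolding s_eq marked_monoid_simps by blast
  qed
qed

lemma finite_R_class_marked_monoid:
  assumes "x \<in> marked_carrier K"
  shows "finite (R_class (marked_monoid K) x)"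
proof -
  interpret inverse_monoid "marked_monoid K"
    by (rule inverse_monoid_marked_monoid)
  obtain p q B n t where x: "x = (p, q, B, n, t)" by (cases x)
  have "R_class (marked_monoid K) x \<subseteq> {p} \<times> {q} \<times> {B} \<times> {p..q} \<times> UNIV"
  proof
    fix y assume y: "y \<in> R_class (marked_monoid K) x"
    obtain p' q' B' n' t' where y_eq: "y = (p', q', B', n', t')" by (cases y)
    \<comment> \<open>The identity puts \<open>z\<close> into its own principal right ideal, so
      \<open>x\<close> and \<open>y\<close> are right multiples of each other, and products only
      enlarge the interval and marks of their left factor.\<close>
    have "z \<in> (\<lambda>u. z \<otimes>\<^bsub>marked_monoid K\<^esub> u) ` carrier (marked_monoid K)"
      if "z \<in> carrier (marked_monoid K)" for z
      using r_one[OF that] one_closed by (metis imageI)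
    then have "x \<in> marked_mult K y ` marked_carrier K" "y \<in> marked_mult K x ` marked_carrier K"
      using y assms unfolding R_class_def green_R_def marked_monoid_simps by blast+
    then obtain u v where u: "x = marked_mult K y u" and v: "y = marked_mult K x v"
      by blast
    have "p \<le> p'" "q' \<le> q" "B' \<subseteq> B"
      using u unfolding x y_eq by (cases u; simp; blast)+
    moreover have "p' \<le> p" "q \<le> q'" "B \<subseteq> B'"
      using v unfolding x y_eq by (cases v; simp; blast)+
    ultimately have "p' = p" "q' = q" "B' = B"
      by auto
    then show "y \<in> {p} \<times> {q} \<times> {B} \<times> {p..q} \<times> UNIV"
      using y by (auto simp: y_eq R_class_def)
  qed
  then show ?thesis
    by (rule finite_subset) auto
qed

section \<open>Generation by three elements\<close>

abbreviation step :: "int \<Rightarrow> marked" where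
  "step k \<equiv> (min 0 k, max 0 k, {}, k, False)"

abbreviation origin_mark :: marked where
  "origin_mark \<equiv> (0, 0, {0}, 0, False)"

abbreviation involution :: marked where
  "involution \<equiv> (0, 0, {}, 0, True)"

lemma three_generated_marked_monoid: "three_generated (marked_monoid K)"
proof -
  interpret inverse_monoid "marked_monoid K"
    by (rule inverse_monoid_marked_monoid)
  let ?X = "{step 1, origin_mark, involution}"
  let ?G = "inv_mon_generate (marked_monoid K) ?X"
  have mult: "marked_mult K x y \<in> ?G" if "x \<in> ?G" "y \<in> ?G" for x y
    using inv_mon_generate.mult[OF that] by simp
  have gens: "step 1 \<in> ?G" "origin_mark \<in> ?G" "involution \<in> ?G"
    by (rule inv_mon_generate.incl; simp)+
  have step_in: "step 1 \<in> carrier (marked_monoid K)"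
    by simp
  have "isg_inv (marked_monoid K) (step 1) = step (- 1)"
    using isg_inv_props[OF step_in] marked_inverse_unique[of 0 1 "{}" 1 False K]
    by simp
  then have step_back: "step (- 1) \<in> ?G"
    using inv_mon_generate.inv[OF gens(1)] by simp
  have nat_steps: "step (int k) \<in> ?G \<and> step (- int k) \<in> ?G" for k
  proof (induction k)
    case 0
    show ?case using inv_mon_generate.one[of "marked_monoid K" ?X] by simp
  next
    case (Suc k)
    have "step (int (Suc k)) = marked_mult K (step (int k)) (step 1)"
      "step (- int (Suc k)) = marked_mult K (step (- int k)) (step (- 1))"
      by auto
    then show ?case using Suc mult gens(1) step_back by metis
  qed
  have steps: "step k \<in> ?G" for k
    using nat_steps[of "nat \<bar>k\<bar>"] by (cases "k \<ge> 0") auto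
  \<comment> \<open>Walking to \<open>x\<close>, marking there and walking back yields the
    idempotent with a single mark at \<open>x\<close>.\<close>
  have marks: "(min 0 x, max 0 x, {x}, 0, False) \<in> ?G" for x
  proof -
    have "marked_mult K (marked_mult K (step x) origin_mark) (step (- x)) \<in> ?G"
      using steps gens mult by blast
    then show ?thesis by (simp add: min_def max_def split: if_splits)
  qed
  have idem: "(p, q, B, 0, False) \<in> ?G" if "finite B" "B \<subseteq> {p..q}" "p \<le> 0" "0 \<le> q" for p q B
    using that
  proof (induction B rule: finite_induct)
    case empty
    \<comment> \<open>Walking to \<open>p\<close> and back, then to \<open>q\<close> and back,
      sweeps out \<open>[p, q]\<close>.\<close>
    have "marked_mult K (marked_mult K (step p) (step (- p)))
      (marked_mult K (step q) (step (- q))) \<in> ?G"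
      using steps mult by blast
    then show ?case using empty by (simp add: min_def max_def split: if_splits)
  next
    case (insert x B)
    then have "marked_mult K (min 0 x, max 0 x, {x}, 0, False) (p, q, B, 0, False) \<in> ?G"
      using marks mult by blast
    moreover have "min (min 0 x) p = p" "max (max 0 x) q = q"
      using insert.prems by auto
    ultimately show ?case by simp
  qed
  have "x \<in> ?G" if "x \<in> marked_carrier K" for x
  proof -
    obtain p q B n t where x: "x = (p, q, B, n, t)" by (cases x)
    have "finite B"
      using that x by (auto intro: finite_subset[OF _ finite_atLeastAtMost_int])
    then have "marked_mult K (p, q, B, 0, False) (step n) \<in> ?G"
      using that x by (intro mult idem steps) auto
    moreover have "min p (min 0 n) = p" "max q (max 0 n) = q"
      using that x by auto
    ultimately have "(p, q, B, n, False) \<in> ?G"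
      by simp
    \<comment> \<open>This sets the exponent exactly when \<open>B\<close> has no gap, which is the
      only case where the carrier admits \<open>t\<close>.\<close>
    moreover from this have "marked_mult K (p, q, B, n, False) involution \<in> ?G"
      using gens mult by blast
    ultimately show ?thesis
      using that unfolding x by (cases t) (auto simp: min_def max_def split: if_splits)
  qed
  moreover have "y \<in> carrier (marked_monoid K)" if "y \<in> ?G" for y
    using that
  proof induction
    case (incl x)
    then show ?case by (auto simp: has_gap_def)
  qed (simp_all add: isg_inv_props del: marked_monoid_simps)
  ultimately have "?G = carrier (marked_monoid K)"
    unfolding marked_monoid_simps by blast
  moreover have "?X \<subseteq> carrier (marked_monoid K)" "card ?X = 3"
    by (auto simp: has_gap_def)
  ultimately show ?thesis
    unfolding three_generated_def by blast
qed

section \<open>Idempotents below the involution\<close>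

lemma idempotents_marked_monoid:
  "idempotents (marked_monoid K) = {(p, q, B, n, t) \<in> marked_carrier K. n = 0 \<and> \<not> t}"
  by (auto simp: idempotents_def subset_iff)

text \<open>The product of an idempotent with \<open>involution\<close> has exponent
  \<open>True\<close> unless its marks have a gap, and idempotents have exponent
  \<open>False\<close>.\<close>

lemma idempotents_below_involution:
  "lambda_set (marked_monoid K) involution \<inter> idempotents (marked_monoid K) =
     {(p, q, B, n, t) \<in> marked_carrier K. n = 0 \<and> \<not> t \<and> has_gap K B}"
proof -
  have "nat_order (marked_monoid K) (p, q, B, 0, False) involution \<longleftrightarrow> has_gap K B"
    if mem: "(p, q, B, 0, False) \<in> marked_carrier K" for p q B
  proof
    assume "nat_order (marked_monoid K) (p, q, B, 0, False) involution"
    then show "has_gap K B"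
      by (auto simp: nat_order_def idempotents_marked_monoid)
  next
    assume "has_gap K B"
    then have "(p, q, B, 0, False) = marked_mult K (p, q, B, 0, False) involution"
      using mem by simp
    moreover have "(p, q, B, 0, False) \<in> idempotents (marked_monoid K)"
      using mem by (simp add: idempotents_marked_monoid)
    moreover have "involution \<in> marked_carrier K"
      by (simp add: has_gap_def)
    ultimately show "nat_order (marked_monoid K) (p, q, B, 0, False) involution"
      using mem unfolding nat_order_def marked_monoid_simps by blast
  qed
  then show ?thesis
    unfolding lambda_set_def idempotents_marked_monoid by auto
qed

lemma infinite_mu_set_marked_monoid:
  assumes "1 \<in> K" and pos: "\<And>k. k \<in> K \<Longrightarrow> 0 < k"
  shows "infinite (mu_set (marked_monoid K) involution)"
proof -
  \<comment> \<open>Two adjacent marks at distance \<open>i\<close> from the origin, in the smallest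
    admissible interval containing them.\<close>
  define e :: "nat \<Rightarrow> marked"
    where "e i = (0, int i + 1, {int i, int i + 1}, 0, False)" for i
  have "e i \<in> mu_set (marked_monoid K) involution" for i
    unfolding mu_set_def idempotents_below_involution
  proof (rule CollectI, intro conjI ballI impI)
    show "e i \<in> {(p, q, B, n, t) \<in> marked_carrier K. n = 0 \<and> \<not> t \<and> has_gap K B}"
      using assms(1) by (auto simp: e_def has_gap_def)
  next
    fix f assume f: "f \<in> {(p, q, B, n, t) \<in> marked_carrier K. n = 0 \<and> \<not> t \<and> has_gap K B}"
      and le: "nat_order (marked_monoid K) (e i) f"
    obtain p q B where f_eq: "f = (p, q, B, 0, False)" and gap: "has_gap K B"
      and pq: "p \<le> 0" "0 \<le> q" "B \<subseteq> {p..q}"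
      using f by auto
    \<comment> \<open>The natural order reverses inclusion: a larger idempotent has a smaller
      interval and fewer marks.\<close>
    have sub: "0 \<le> p" "q \<le> int i + 1" "B \<subseteq> {int i, int i + 1}"
      using le by (auto simp: nat_order_def idempotents_marked_monoid e_def f_eq)
    \<comment> \<open>Since \<open>K\<close> is positive, a gap takes two distinct marks, so
      \<open>B\<close> must contain both marks of \<open>e i\<close>.\<close>
    obtain x y where "x \<in> B" "y \<in> B" "x < y"
      using gap pos by (force simp: has_gap_def)
    moreover from this have "x \<in> {int i, int i + 1}" "y \<in> {int i, int i + 1}"
      using sub(3) by blast+
    ultimately have "int i \<in> B" "int i + 1 \<in> B"
      by auto
    then have "B = {int i, int i + 1}"
      using sub(3) by blast
    then show "f = e i"
      using sub pq by (simp add: f_eq e_def)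
  qed
  then have "range e \<subseteq> mu_set (marked_monoid K) involution"
    by blast
  moreover have "inj e"
    by (auto simp: inj_def e_def)
  ultimately show ?thesis
    by (meson finite_subset range_inj_infinite)
qed

section \<open>Countability of the isomorphism classes\<close>

text \<open>In \<^term>\<open>marked_monoid K\<close> with \<open>a\<close>, \<open>a'\<close> the steps by \<open>1\<close> and \<open>-1\<close> and \<open>b\<close> the mark at the
  origin, this is the idempotent with marks at \<open>0\<close> and \<open>k\<close>.\<close>

definition two_marks :: "('a, 'b) monoid_scheme \<Rightarrow> 'a \<Rightarrow> 'a \<Rightarrow> 'a \<Rightarrow> nat \<Rightarrow> 'a" where
  "two_marks T a a' b k = b \<otimes>\<^bsub>T\<^esub> ((\<lambda>x. a \<otimes>\<^bsub>T\<^esub> (x \<otimes>\<^bsub>T\<^esub> a')) ^^ k) b"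

lemma two_marks_marked_monoid:
  "two_marks (marked_monoid K) (step 1) (step (- 1)) origin_mark k =
     (0, int k, {0, int k}, 0, False)"
proof -
  have "((\<lambda>x. marked_mult K (step 1) (marked_mult K x (step (- 1)))) ^^ k) origin_mark =
      (0, int k, {int k}, 0, False)"
    by (induction k) auto
  then show ?thesis
    by (simp add: two_marks_def insert_commute)
qed

lemma hom_two_marks:
  assumes "monoid S" "h \<in> hom S T" "a \<in> carrier S" "a' \<in> carrier S" "b \<in> carrier S"
  shows "h (two_marks S a a' b k) = two_marks T (h a) (h a') (h b) k"
    and "two_marks S a a' b k \<in> carrier S"
proof -
  interpret S: monoid S by fact
  let ?f = "\<lambda>x. a \<otimes>\<^bsub>S\<^esub> (x \<otimes>\<^bsub>S\<^esub> a')" and ?g = "\<lambda>x. h a \<otimes>\<^bsub>T\<^esub> (x \<otimes>\<^bsub>T\<^esub> h a')"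
  have "(?f ^^ k) b \<in> carrier S \<and> h ((?f ^^ k) b) = (?g ^^ k) (h b)"
    using assms by (induction k) (auto simp: hom_mult)
  then show "h (two_marks S a a' b k) = two_marks T (h a) (h a') (h b) k"
    and "two_marks S a a' b k \<in> carrier S"
    using assms by (auto simp: two_marks_def hom_mult)
qed

text \<open>The element 1 secures infinitely many maximal idempotents; the shift by 2 keeps the code
  of \<open>A\<close> apart from it, so \<open>A\<close> can be recovered.\<close>

definition gap_set :: "nat set \<Rightarrow> int set" where
  "gap_set A = insert 1 ((\<lambda>k. int k + 2) ` A)"

lemma gap_set_pos: "k \<in> gap_set A \<Longrightarrow> 0 < k"
  by (auto simp: gap_set_def)

lemma two_marks_fixed_iff:
  fixes A k
  defines "S \<equiv> marked_monoid (gap_set A)"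
  defines "w \<equiv> two_marks S (step 1) (step (- 1)) origin_mark (k + 2)"
  shows "w \<otimes>\<^bsub>S\<^esub> involution = w \<longleftrightarrow> k \<in> A"
proof -
  \<comment> \<open>The only positive difference is \<open>k + 2\<close>, which differs from
    1.\<close>
  have "has_gap (gap_set A) {0, int k + 2} \<longleftrightarrow> k \<in> A"
    by (auto simp: has_gap_def gap_set_def)
  then show ?thesis
    unfolding w_def S_def two_marks_marked_monoid by (simp add: add.commute)
qed

lemma countable_isomorphic_marked_monoids:
  fixes T :: "('a :: countable) monoid"
  shows "countable {A. marked_monoid (gap_set A) \<cong> T}"
proof -
  \<comment> \<open>\<open>D\<close> decodes \<open>A\<close> from candidate images in
    \<open>T\<close> without reference to an isomorphism; its domain, the quadruples over a
    countable type, is countable.\<close>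
  define D where "D = (\<lambda>(a, a', b, c).
    {k. two_marks T a a' b (k + 2) \<otimes>\<^bsub>T\<^esub> c = two_marks T a a' b (k + 2)})"
  have "A \<in> range D" if iso: "marked_monoid (gap_set A) \<cong> T" for A
  proof -
    let ?S = "marked_monoid (gap_set A)"
    interpret S: inverse_monoid ?S
      by (rule inverse_monoid_marked_monoid)
    obtain h where h: "h \<in> hom ?S T" "inj_on h (carrier ?S)"
      using iso by (auto simp: is_iso_def iso_def bij_betw_def)
    have gens: "step 1 \<in> carrier ?S" "step (- 1) \<in> carrier ?S" "origin_mark \<in> carrier ?S"
      "involution \<in> carrier ?S"
      by (auto simp: has_gap_def)
    have "A = D (h (step 1), h (step (- 1)), h origin_mark, h involution)"
    proof (rule Set.set_eqI)
      fix k
      let ?w = "two_marks ?S (step 1) (step (- 1)) origin_mark (k + 2)"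
      note w = hom_two_marks[OF S.monoid_axioms h(1) gens(1-3), of "k + 2"]
      have "k \<in> A \<longleftrightarrow> ?w \<otimes>\<^bsub>?S\<^esub> involution = ?w"
        using two_marks_fixed_iff by blast
      also have "\<dots> \<longleftrightarrow> h (?w \<otimes>\<^bsub>?S\<^esub> involution) = h ?w"
        using h(2) w(2) gens(4) S.m_closed by (metis inj_onD)
      also have "\<dots> \<longleftrightarrow> h ?w \<otimes>\<^bsub>T\<^esub> h involution = h ?w"
        using hom_mult[OF h(1) w(2) gens(4)] by simp
      finally show "k \<in> A \<longleftrightarrow> k \<in> D (h (step 1), h (step (- 1)), h origin_mark, h involution)"
        unfolding D_def w(1) by simp
    qed
    then show ?thesis by blast
  qed
  then have "{A. marked_monoid (gap_set A) \<cong> T} \<subseteq> range D"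
    by blast
  then show ?thesis
    by (rule countable_subset) simp
qed

section \<open>Uncountably many isomorphism types on sets of natural numbers\<close>

lemma uncountable_UNIV_nat_set: "uncountable (UNIV :: nat set set)"
proof
  assume "countable (UNIV :: nat set set)"
  then obtain f :: "nat \<Rightarrow> nat set" where "range f = UNIV"
    using uncountable_def by (metis UNIV_not_empty)
  then show False
    using Cantors_theorem[of UNIV] by auto
qed

theorem proposition3p3:
  shows "\<exists>\<F> :: nat monoid set.
    uncountable \<F> \<and>
    pairwise (\<lambda>S T. \<not> S \<cong> T) \<F> \<and>
    (\<forall>S \<in> \<F>. inverse_monoid S \<and> three_generated S \<and>
       (\<forall>a \<in> carrier S. finite (R_class S a)) \<and>
       (\<exists>s \<in> carrier S. infinite (mu_set S s)))"
proof -
  define S where "S A = marked_monoid (gap_set A)" for A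
  define c where "c A = to_nat_on (carrier (S A))" for A
  define T where "T A = image_monoid (c A) (S A)" for A
  have iso: "inverse_monoid_iso (S A) (T A) (c A)" for A
    unfolding T_def S_def c_def
    by (intro inverse_monoid_iso_image_monoid inverse_monoid_marked_monoid inj_on_to_nat_on)
      (simp add: countable_marked_carrier)
  have ST: "S A \<cong> T A" for A
    using inverse_monoid_iso.h[OF iso] by (auto simp: is_iso_def)
  \<comment> \<open>Since \<open>S A' \<cong> T A'\<close>, each such \<open>A'\<close> also
    satisfies \<open>S A' \<cong> T A\<close>, where countability is known.\<close>
  have "countable {A'. T A' \<cong> T A}" for A
    using countable_isomorphic_marked_monoids[of "T A"] ST iso_trans
    by (force simp flip: S_def intro: countable_subset[rotated])
  moreover have "monoid (T A)" for A
    using iso[of A] by (simp add: inverse_monoid_iso_def)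
  ultimately obtain \<F> where \<F>: "\<F> \<subseteq> range T" "uncountable \<F>"
    "pairwise (\<lambda>S T. \<not> S \<cong> T) \<F>"
    using uncountable_pairwise_nonisomorphic[of T] uncountable_UNIV_nat_set by blast
  have props: "inverse_monoid (T A) \<and> three_generated (T A) \<and>
       (\<forall>a \<in> carrier (T A). finite (R_class (T A) a)) \<and>
       (\<exists>s \<in> carrier (T A). infinite (mu_set (T A) s))" for A
  proof -
    interpret inverse_monoid_iso "S A" "T A" "c A" by (rule iso)
    have "finite (R_class (T A) a)" if "a \<in> carrier (T A)" for a
    proof -
      obtain x where "x \<in> carrier (S A)" "a = c A x"
        using \<open>a \<in> carrier (T A)\<close> image_carrier by blast
      then show ?thesis
        by (simp add: R_class_image S_def finite_R_class_marked_monoid)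
    qed
    moreover have inv: "involution \<in> carrier (S A)"
      by (simp add: S_def has_gap_def)
    have "infinite (mu_set (S A) involution)"
      unfolding S_def
      by (rule infinite_mu_set_marked_monoid) (auto simp: gap_set_pos, simp add: gap_set_def)
    then have "infinite (mu_set (T A) (c A involution))"
      unfolding mu_set_image[OF inv]
      by (subst finite_image_iff) (auto intro: inj_on_subset[OF inj] simp: mu_set_def lambda_set_def)
    ultimately show ?thesis
      using h_closed[OF inv] inverse_monoid_T three_generated_T three_generated_marked_monoid
      unfolding S_def by blast
  qed
  show ?thesis
  proof (intro exI[of _ \<F>] conjI[OF \<F>(2)] conjI[OF \<F>(3)] ballI)
    fix S assume "S \<in> \<F>"
    then obtain A where "S = T A"
      using \<F>(1) by blast
    then show "inverse_monoid S \<and> three_generated S \<and>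
       (\<forall>a \<in> carrier S. finite (R_class S a)) \<and>
       (\<exists>s \<in> carrier S. infinite (mu_set S s))"
      using props[of A] by simp
  qed
qed

end
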